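(* Let $\widehat{\mathbf{A}}\in\mathbb{R}^{d\times d}$ be a nonzero symmetric matrix. Let $\mathbf{A}_1,\dots,\mathbf{A}_L\in\mathbb{R}^{d\times d}$ be symmetric matrices such that $\widehat{\mathbf{A}}=\sum_{k=1}^L\mathbf{A}_k$, and for $1\le k\le L$ let $\mathbf{B}_k$ equal $\mathbf{A}_k$ but with the diagonal entries set to zero. For positive integer sample sizes $\mathbf{m}=\{m_k\}_{k=1}^L$, define $$\Gamma_{\mathbf{m}}=\sum_{k=1}^L\sum_{i=1}^{m_k}\frac{1}{m_k}\,(\mathbf{z}^{(i,k)})^T\mathbf{A}_k\,\mathbf{z}^{(i,k)},$$ where the $\mathbf{z}^{(i,k)}\in\mathbb{R}^d$ ($1\le k\le L$, $1\le i\le m_k$) are independent Rademacher vectors. Then for all $\varepsilon>0$, $$\Pr\left(|\Gamma_{\mathbf{m}}-\operatorname{tr}(\widehat{\mathbf{A}})|\ge\varepsilon\right)\le 2\exp\left(\frac{-\varepsilon^2/8}{\sum_{k=1}^L\|\mathbf{B}_k\|_F^2/m_k+\varepsilon\max_{1\le k\le L}\|\mathbf{B}_k\|_2/m_k}\right).$$ Furthermore, let $\varepsilon>0$ and $\delta>0$, for $1\le k\le L$ let $V_k=\|\mathbf{B}_k\|_F^2+\varepsilon\|\mathbf{B}_k\|_2$, and let $C_k>0$ be the cost of sampling from $\mathbf{B}_k$. If $m_k\ge\mu\sqrt{V_k/C_k}$ for all $1\le k\le L$, where $$\mu=8\varepsilon^{-2}\log(2/\delta)\sum_{k=1}^L\sqrt{V_kC_k},$$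 then $\Pr\left(|\Gamma_{\mathbf{m}}-\operatorname{tr}(\widehat{\mathbf{A}})|\ge\varepsilon\right)\le\delta$.
   Context: A Rademacher vector is a random vector whose entries are independent and equal to $\pm1$ with probability $1/2$ each. $\|\cdot\|_F$ is the Frobenius norm, $\|\cdot\|_2$ is the operator (spectral) norm, $\operatorname{tr}$ is the trace, and $\log$ is the natural logarithm. The costs $C_k$ enter only as given positive real numbers. If all $\mathbf{B}_k$ are zero, the right-hand side of the first bound is interpreted as $2\exp(-\infty)=0$. *)

theory Defs
  imports "HOL-Probability.Probability"
begin

definition frobenius_norm :: "real ^ 'n ^ 'm \<Rightarrow> real" where
  "frobenius_norm A = sqrt (\<Sum>i\<in>UNIV. \<Sum>j\<in>UNIV. (A $ i $ j)\<^sup>2)"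

(* The operator norm with respect to the Euclidean norms: the norm on real ^ 'n is Euclidean. *)
definition spectral_norm :: "real ^ 'n ^ 'm \<Rightarrow> real" where
  "spectral_norm A = onorm (\<lambda>x. A *v x)"

definition zero_diagonal :: "real ^ 'n ^ 'n \<Rightarrow> real ^ 'n ^ 'n" where
  "zero_diagonal A = (\<chi> i j. if i = j then 0 else A $ i $ j)"

definition (in prob_space) rademacher_vector :: "('a \<Rightarrow> real ^ 'n) \<Rightarrow> bool" where
  "rademacher_vector X \<longleftrightarrow>
     indep_vars (\<lambda>_. borel) (\<lambda>j \<omega>. X \<omega> $ j) UNIV \<and>
     (\<forall>j. prob {\<omega> \<in> space M. X \<omega> $ j = 1} = 1 / 2 \<and>
          prob {\<omega> \<in> space M. X \<omega> $ j = - 1} = 1 / 2)"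

definition multilevel_estimator ::
  "nat \<Rightarrow> (nat \<Rightarrow> nat) \<Rightarrow> (nat \<Rightarrow> real ^ 'n ^ 'n) \<Rightarrow> (nat \<Rightarrow> nat \<Rightarrow> 'a \<Rightarrow> real ^ 'n) \<Rightarrow> 'a \<Rightarrow> real"
where
  "multilevel_estimator L m A z \<omega> =
     (\<Sum>k=1..L. \<Sum>i=1..m k. 1 / real (m k) * (z k i \<omega> \<bullet> (A k *v z k i \<omega>)))"

(* The first branch is the convention 2 * exp (- infinity) = 0: without it, division by zero
   would make the bound equal to 2 * exp 0 = 2 when every matrix B k vanishes. *)
definition tail_bound :: "nat \<Rightarrow> (nat \<Rightarrow> nat) \<Rightarrow> (nat \<Rightarrow> real ^ 'n ^ 'n) \<Rightarrow> real \<Rightarrow> real" where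
  "tail_bound L m B \<epsilon> =
     (if \<forall>k\<in>{1..L}. B k = 0 then 0
      else 2 * exp ((- \<epsilon>\<^sup>2 / 8) /
             ((\<Sum>k=1..L. (frobenius_norm (B k))\<^sup>2 / real (m k)) +
              \<epsilon> * (MAX k\<in>{1..L}. spectral_norm (B k) / real (m k)))))"

end

theory Submission
  imports Defs
begin

text \<open>Let \<open>B\<close> be symmetric with zero diagonal, \<open>q x = x \<bullet> (B *v x)\<close>, \<open>F\<close> its Frobenius and \<open>S\<close> its
  spectral norm, and let \<open>Z t\<close> and \<open>G t\<close> be the sums over the hypercube of \<open>exp (t * q x)\<close> and
  \<open>(norm (B *v x))\<^sup>2 * exp (t * q x)\<close>. As \<open>q\<close> is affine in each coordinate, summing over one
  coordinate at a time and \<open>\<bar>tanh u\<bar> \<le> \<bar>u\<bar>\<close> give \<open>Z' \<le> 2 t G\<close>. The same step for the quadratic form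
  of \<open>B ** B\<close> gives \<open>G \<le> F\<^sup>2 Z + t S (F\<^sup>2 Z + 3 G)\<close>, hence \<open>G \<le> F\<^sup>2 Z / (1 - 4 t S)\<close>. Integrating,
  the moment generating function of \<open>q\<close> is at most \<open>exp (t\<^sup>2 F\<^sup>2 / (1 - 4 t S))\<close>. These bounds multiply
  over the independent samples, and the Chernoff bound with \<open>t = \<epsilon> / (4 (v + \<epsilon> S))\<close>, where \<open>v\<close> and \<open>S\<close>
  now denote the two terms of the tail bound, concludes. The diagonal part of each quadratic form is
  almost surely the trace. The second claim follows by bounding the maximum by the sum.\<close>

section \<open>Exponential sums of quadratic forms over the hypercube\<close>

definition hypercube :: "(real ^ 'n) set" where
  "hypercube = {x. \<forall>i. x $ i = 1 \<or> x $ i = - 1}"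

text \<open>The reflection is written as subtraction of a multiple of a basis vector, so that
  linearity expands \<open>B *v flip i x\<close> and inner products directly.\<close>

definition flip :: "'n \<Rightarrow> real ^ 'n \<Rightarrow> real ^ 'n" where
  "flip i x = x - (2 * x $ i) *\<^sub>R axis i 1"

lemma flip_nth: "flip i x $ j = (if j = i then - x $ j else x $ j)"
  by (simp add: flip_def axis_def)

lemma flip_flip [simp]: "flip i (flip i x) = x"
  by (simp add: vec_eq_iff flip_nth)

lemma flip_in_hypercube: "x \<in> hypercube \<Longrightarrow> flip i x \<in> hypercube"
  by (force simp: hypercube_def flip_nth)

lemma finite_hypercube: "finite (hypercube :: (real ^ 'n) set)"
proof -
  have "x \<in> range (\<lambda>I. \<chi> i. if i \<in> I then 1 else - 1)" if "x \<in> hypercube" for x :: "real ^ 'n"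
    using that by (intro image_eqI[of _ _ "{i. x $ i = 1}"]) (auto simp: hypercube_def vec_eq_iff)
  then have "(hypercube :: (real ^ 'n) set) \<subseteq> range (\<lambda>I. \<chi> i. if i \<in> I then 1 else - 1)"
    by blast
  then show ?thesis
    by (rule finite_subset) simp
qed

lemma abs_hypercube: "x \<in> hypercube \<Longrightarrow> \<bar>x $ i\<bar> = 1"
  by (metis (mono_tags, lifting) abs_1 abs_minus_cancel hypercube_def mem_Collect_eq)

lemma square_hypercube: "x \<in> hypercube \<Longrightarrow> x $ i * x $ i = 1"
  by (metis abs_hypercube abs_mult_self_eq mult_1)

lemma sum_flip:
  fixes g :: "real ^ 'n \<Rightarrow> real"
  shows "(\<Sum>x\<in>hypercube. g (flip i x)) = (\<Sum>x\<in>hypercube. g x)"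
  by (rule sum.reindex_bij_witness[of _ "flip i" "flip i"]) (auto simp: flip_in_hypercube)

section \<open>A tanh inequality for differences of exponentials\<close>

text \<open>This is tanh (d/2) \<le> d/2 with the denominator cleared. Both sides agree at 0, and
  their difference decreases because 1 - x \<le> exp (- x).\<close>

lemma exp_minus_one_le: "d \<ge> 0 \<Longrightarrow> exp d - 1 \<le> d / 2 * (exp d + 1)" for d :: real
proof -
  assume d: "d \<ge> 0"
  have "(exp 0 - 1) - 0 / 2 * (exp 0 + 1) \<ge> (exp d - 1) - d / 2 * (exp d + 1 :: real)"
  proof (rule DERIV_nonpos_imp_nonincreasing[OF d])
    fix x :: real
    have "((\<lambda>d. (exp d - 1) - d / 2 * (exp d + 1)) has_real_derivative
        exp x - (exp x + 1) / 2 - x / 2 * exp x) (at x)"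
      by (auto intro!: derivative_eq_intros simp: field_simps)
    moreover have "(1 - x) * exp x \<le> exp (- x) * exp x"
      using exp_ge_add_one_self[of "- x"] by (intro mult_right_mono) auto
    then have "exp x - (exp x + 1) / 2 - x / 2 * exp x \<le> 0"
      by (simp add: field_simps flip: exp_add)
    ultimately show "\<exists>y. ((\<lambda>d. (exp d - 1) - d / 2 * (exp d + 1)) has_real_derivative y) (at x) \<and> y \<le> 0"
      by blast
  qed
  then show ?thesis by simp
qed

text \<open>Factoring out the smaller exponential reduces this to the one-variable inequality at the
  absolute difference of \<open>a\<close> and \<open>b\<close>.\<close>

lemma abs_exp_diff_le: "\<bar>exp a - exp b\<bar> \<le> \<bar>a - b\<bar> / 2 * (exp a + exp b)" for a b :: real
proof -
  have *: "exp a - exp b \<le> (a - b) / 2 * (exp a + exp b)" if "b \<le> a" for a b :: real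
  proof -
    have "(exp (a - b) - 1) * exp b \<le> ((a - b) / 2 * (exp (a - b) + 1)) * exp b"
      using that by (intro mult_right_mono exp_minus_one_le) auto
    then show ?thesis
      by (simp add: left_diff_distrib distrib_right mult.assoc flip: exp_add)
  qed
  show ?thesis
  proof (cases "b \<le> a")
    case True
    then show ?thesis using *[of b a] by simp
  next
    case False
    then show ?thesis using *[of a b] by (simp add: add.commute)
  qed
qed

section \<open>Discrete integration by parts in each coordinate\<close>

lemma inner_matrix_vector_symmetric:
  fixes B :: "real ^ 'n ^ 'n"
  assumes "transpose B = B"
  shows "x \<bullet> (B *v y) = (B *v x) \<bullet> y"
  by (metis assms dot_lmul_matrix transpose_matrix_vector)

lemma matrix_vector_flip_nth:
  fixes P :: "real ^ 'n ^ 'n"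
  shows "(P *v flip i x) $ i = (P *v x) $ i - 2 * x $ i * P $ i $ i"
  by (simp add: flip_def matrix_vector_mult_diff_distrib matrix_vector_mult_scaleR
      matrix_vector_mult_basis column_def)

text \<open>The second-order term of the flip is a multiple of \<open>B $ i $ i\<close> and
  vanishes; by symmetry the two cross terms coincide.\<close>

lemma quadratic_form_flip:
  fixes B :: "real ^ 'n ^ 'n"
  assumes "transpose B = B" "B $ i $ i = 0"
  shows "flip i x \<bullet> (B *v flip i x) = x \<bullet> (B *v x) - 4 * (x $ i * (B *v x) $ i)"
proof -
  have 1: "(B *v axis i 1) $ i = 0"
    using assms(2) by (simp add: matrix_vector_mult_basis column_def)
  have 2: "x \<bullet> (B *v axis i 1) = (B *v x) $ i"
    by (simp add: inner_matrix_vector_symmetric[OF assms(1)] inner_axis)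
  show ?thesis
    by (simp add: flip_def matrix_vector_mult_diff_distrib matrix_vector_mult_scaleR
        inner_diff_left inner_diff_right 1 2 inner_axis')
qed

text \<open>Pairing \<open>x\<close> with \<open>flip i x\<close> is a discrete integration by parts in the coordinate \<open>i\<close>,
  as \<open>c\<close> and \<open>(B *v x) $ i\<close> do not depend on that coordinate.\<close>

lemma sum_coordinate_exp_le:
  fixes B :: "real ^ 'n ^ 'n" and c :: "real ^ 'n \<Rightarrow> real"
  assumes B: "transpose B = B" "B $ i $ i = 0" and t: "t \<ge> 0"
    and c: "\<And>x. c (flip i x) = c x"
  shows "(\<Sum>x\<in>hypercube. x $ i * c x * exp (t * (x \<bullet> (B *v x))))
    \<le> 2 * t * (\<Sum>x\<in>hypercube. \<bar>c x\<bar> * \<bar>(B *v x) $ i\<bar> * exp (t * (x \<bullet> (B *v x))))"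
proof -
  define w where "w x = exp (t * (x \<bullet> (B *v x)))" for x
  define b where "b x = (B *v x) $ i" for x
  have b: "b (flip i x) = b x" for x
    using B(2) by (simp add: b_def matrix_vector_flip_nth)
  have w: "x $ i * c x * (w x - w (flip i x)) \<le> 2 * t * (\<bar>c x\<bar> * \<bar>b x\<bar> * (w x + w (flip i x)))"
    if x: "x \<in> hypercube" for x
  proof -
    have "x $ i * c x * (w x - w (flip i x)) \<le> \<bar>x $ i * c x * (w x - w (flip i x))\<bar>"
      by (rule abs_ge_self)
    also have "\<dots> = \<bar>c x\<bar> * \<bar>w x - w (flip i x)\<bar>"
      by (simp add: abs_mult abs_hypercube[OF x])
    \<comment> \<open>Flipping changes the exponent by \<open>4 * t * (x $ i * b x)\<close>; the
      half in \<open>abs_exp_diff_le\<close> leaves the factor \<open>2 * t\<close>.\<close>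
    also have "\<dots> \<le> \<bar>c x\<bar> * (\<bar>4 * t * (x $ i * b x)\<bar> / 2 * (w x + w (flip i x)))"
      unfolding w_def
      by (intro mult_left_mono order_trans[OF abs_exp_diff_le])
        (auto simp: quadratic_form_flip[OF B] b_def algebra_simps)
    also have "\<dots> = 2 * t * (\<bar>c x\<bar> * \<bar>b x\<bar> * (w x + w (flip i x)))"
      using t by (simp add: abs_mult abs_hypercube[OF x])
    finally show ?thesis .
  qed
  \<comment> \<open>The flip reverses the sign of \<open>x $ i\<close> and keeps \<open>c x\<close>,
    so adding the reflected sum produces the difference of the two weights.\<close>
  have "2 * (\<Sum>x\<in>hypercube. x $ i * c x * w x)
      = (\<Sum>x\<in>hypercube. x $ i * c x * w x)
        + (\<Sum>x\<in>hypercube. flip i x $ i * c (flip i x) * w (flip i x))"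
    using sum_flip[of "\<lambda>x. x $ i * c x * w x"] by simp
  also have "\<dots> = (\<Sum>x\<in>hypercube. x $ i * c x * (w x - w (flip i x)))"
    by (simp add: sum.distrib[symmetric] c flip_nth algebra_simps)
  also have "\<dots> \<le> (\<Sum>x\<in>hypercube. 2 * t * (\<bar>c x\<bar> * \<bar>b x\<bar> * (w x + w (flip i x))))"
    by (intro sum_mono w)
  also have "\<dots> = 2 * t * ((\<Sum>x\<in>hypercube. \<bar>c x\<bar> * \<bar>b x\<bar> * w x)
        + (\<Sum>x\<in>hypercube. \<bar>c (flip i x)\<bar> * \<bar>b (flip i x)\<bar> * w (flip i x)))"
    by (simp add: sum.distrib[symmetric] sum_distrib_left c b algebra_simps)
  also have "\<dots> = 2 * (2 * t * (\<Sum>x\<in>hypercube. \<bar>c x\<bar> * \<bar>b x\<bar> * w x))"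
    by (subst sum_flip[of "\<lambda>x. \<bar>c x\<bar> * \<bar>b x\<bar> * w x"]) simp
  finally show ?thesis
    by (simp add: w_def b_def)
qed

text \<open>Squares of coordinates are 1, so the diagonal of \<open>P\<close> contributes
  \<open>trace P\<close>. What remains is a sum of \<open>x $ i\<close> times a factor whose
  dependence on coordinate \<open>i\<close> has been subtracted, so integration by parts applies for
  each \<open>i\<close>. \<open>P\<close> is separate from \<open>B\<close> because both
  \<open>P = B\<close> and \<open>P = B ** B\<close> are used.\<close>

lemma sum_quadratic_form_exp_le:
  fixes B P :: "real ^ 'n ^ 'n"
  assumes B: "transpose B = B" "\<And>i. B $ i $ i = 0" and t: "t \<ge> 0"
  shows "(\<Sum>x\<in>hypercube. (x \<bullet> (P *v x)) * exp (t * (x \<bullet> (B *v x))))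
    \<le> (\<Sum>x\<in>hypercube. (trace P
          + 2 * t * (\<Sum>i\<in>UNIV. \<bar>(P *v x) $ i - P $ i $ i * x $ i\<bar> * \<bar>(B *v x) $ i\<bar>))
        * exp (t * (x \<bullet> (B *v x))))"
proof -
  define w where "w x = exp (t * (x \<bullet> (B *v x)))" for x
  define c where "c i x = (P *v x) $ i - P $ i $ i * x $ i" for i x
  have split: "x \<bullet> (P *v x) = trace P + (\<Sum>i\<in>UNIV. x $ i * c i x)" if "x \<in> hypercube" for x
  proof -
    have "x \<bullet> (P *v x) = (\<Sum>i\<in>UNIV. P $ i $ i * (x $ i * x $ i) + x $ i * c i x)"
      by (simp add: inner_vec_def c_def algebra_simps)
    then show ?thesis
      by (simp add: sum.distrib trace_def square_hypercube[OF that])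
  qed
  have c: "c i (flip i x) = c i x" for i x
    by (simp add: c_def matrix_vector_flip_nth flip_nth)
  have "(\<Sum>x\<in>hypercube. (x \<bullet> (P *v x)) * w x)
      = (\<Sum>x\<in>hypercube. trace P * w x + (\<Sum>i\<in>UNIV. x $ i * c i x * w x))"
    by (intro sum.cong) (simp_all add: split distrib_right sum_distrib_right)
  also have "\<dots> = (\<Sum>x\<in>hypercube. trace P * w x) + (\<Sum>i\<in>UNIV. \<Sum>x\<in>hypercube. x $ i * c i x * w x)"
    by (simp add: sum.distrib) (rule sum.swap)
  also have "\<dots> \<le> (\<Sum>x\<in>hypercube. trace P * w x)
      + (\<Sum>i\<in>UNIV. 2 * t * (\<Sum>x\<in>hypercube. \<bar>c i x\<bar> * \<bar>(B *v x) $ i\<bar> * w x))"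
    unfolding w_def by (intro add_left_mono sum_mono sum_coordinate_exp_le B t c)
  also have "\<dots> = (\<Sum>x\<in>hypercube. trace P * w x)
      + 2 * t * (\<Sum>x\<in>hypercube. \<Sum>i\<in>UNIV. \<bar>c i x\<bar> * \<bar>(B *v x) $ i\<bar> * w x)"
    by (subst sum.swap) (simp add: sum_distrib_left)
  also have "\<dots> = (\<Sum>x\<in>hypercube. (trace P + 2 * t * (\<Sum>i\<in>UNIV. \<bar>c i x\<bar> * \<bar>(B *v x) $ i\<bar>)) * w x)"
    by (simp add: distrib_right sum.distrib sum_distrib_left sum_distrib_right mult.assoc)
  finally show ?thesis
    by (simp add: w_def c_def)
qed

section \<open>Spectral and Frobenius estimates for the square of a symmetric matrix\<close>

lemma norm_matrix_vector_le_spectral: "norm (B *v x) \<le> spectral_norm B * norm x"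
  for B :: "real ^ 'n ^ 'm"
  unfolding spectral_norm_def by (rule onorm[OF matrix_vector_mul_bounded_linear])

lemma spectral_norm_nonneg: "0 \<le> spectral_norm B" for B :: "real ^ 'n ^ 'm"
  unfolding spectral_norm_def by (rule onorm_pos_le[OF matrix_vector_mul_bounded_linear])

lemma trace_square_symmetric:
  fixes B :: "real ^ 'n ^ 'n"
  assumes "transpose B = B"
  shows "trace (B ** B) = (frobenius_norm B)\<^sup>2"
proof -
  have "B $ j $ i = B $ i $ j" for i j
    using assms by (metis transpose_def vec_lambda_beta)
  then show ?thesis
    by (simp add: trace_def frobenius_norm_def matrix_matrix_mult_def sum_nonneg power2_eq_square)
qed

text \<open>As squared column norms, the diagonal entries are nonnegative and their roots are at
  most the spectral norm.\<close>

lemma diag_square_symmetric: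
  fixes B :: "real ^ 'n ^ 'n"
  assumes "transpose B = B"
  shows "(B ** B) $ i $ i = (norm (B *v axis i 1))\<^sup>2"
proof -
  have "B $ j $ i = B $ i $ j" for i j
    using assms by (metis transpose_def vec_lambda_beta)
  then show ?thesis
    by (simp add: matrix_vector_mult_basis column_def power2_norm_eq_inner inner_vec_def
        matrix_matrix_mult_def)
qed

lemma sum_abs_mult_le_norm: "(\<Sum>i\<in>UNIV. \<bar>x $ i\<bar> * \<bar>y $ i\<bar>) \<le> norm x * norm y"
  for x y :: "real ^ 'n"
proof -
  have "(\<Sum>i\<in>UNIV. \<bar>x $ i\<bar> * \<bar>y $ i\<bar>) = (\<chi> i. \<bar>x $ i\<bar>) \<bullet> (\<chi> i. \<bar>y $ i\<bar>)"
    by (simp add: inner_vec_def)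
  also have "\<dots> \<le> norm (\<chi> i. \<bar>x $ i\<bar>) * norm (\<chi> i. \<bar>y $ i\<bar>)"
    by (rule norm_cauchy_schwarz)
  also have "\<dots> = norm x * norm y"
    by (simp add: norm_vec_def)
  finally show ?thesis .
qed

text \<open>With \<open>b = B *v x\<close> one has \<open>P *v x = B *v b\<close>, and
  Cauchy-Schwarz bounds its pairing with \<open>b\<close> by S times the squared norm of
  \<open>b\<close>. The subtracted diagonal costs at most S/2 times the sum of F^2 and that squared
  norm.\<close>

lemma off_diagonal_square_le:
  fixes B :: "real ^ 'n ^ 'n"
  assumes B: "transpose B = B" and x: "x \<in> hypercube"
  defines "P \<equiv> B ** B" and "S \<equiv> spectral_norm B" and "F \<equiv> frobenius_norm B"
  shows "(\<Sum>i\<in>UNIV. \<bar>(P *v x) $ i - P $ i $ i * x $ i\<bar> * \<bar>(B *v x) $ i\<bar>)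
    \<le> S * (F\<^sup>2 + 3 * (norm (B *v x))\<^sup>2) / 2"
proof -
  define b where "b = B *v x"
  \<comment> \<open>The diagonal entry is p^2 with p \<le> S: one factor p is absorbed by S, the
    other is paired with the entry of \<open>b\<close> by the AM-GM inequality.\<close>
  have Pd: "P $ i $ i * \<bar>b $ i\<bar> \<le> S * (P $ i $ i + (b $ i)\<^sup>2) / 2" for i
  proof -
    define p where "p = norm (B *v axis i 1)"
    have p: "P $ i $ i = p\<^sup>2"
      unfolding P_def p_def by (rule diag_square_symmetric[OF B])
    have "p \<le> S"
      using norm_matrix_vector_le_spectral[of B "axis i 1"] by (simp add: p_def S_def norm_axis_1)
    have "P $ i $ i * \<bar>b $ i\<bar> = p * (p * \<bar>b $ i\<bar>)"
      by (simp add: p power2_eq_square)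
    also have "\<dots> \<le> S * (p * \<bar>b $ i\<bar>)"
      using \<open>p \<le> S\<close> by (intro mult_right_mono) (auto simp: p_def)
    also have "\<dots> \<le> S * ((p\<^sup>2 + (b $ i)\<^sup>2) / 2)"
      using sum_squares_bound[of p "\<bar>b $ i\<bar>"] spectral_norm_nonneg[of B]
      by (intro mult_left_mono) (auto simp: S_def)
    finally show ?thesis by (simp add: p)
  qed
  have P0: "0 \<le> P $ i $ i" for i
    unfolding P_def by (simp add: diag_square_symmetric[OF B])
  have "(\<Sum>i\<in>UNIV. \<bar>(P *v x) $ i - P $ i $ i * x $ i\<bar> * \<bar>b $ i\<bar>)
      \<le> (\<Sum>i\<in>UNIV. (\<bar>(B *v b) $ i\<bar> + P $ i $ i) * \<bar>b $ i\<bar>)"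
  proof (intro sum_mono mult_right_mono)
    fix i
    have "\<bar>(P *v x) $ i - P $ i $ i * x $ i\<bar> \<le> \<bar>(P *v x) $ i\<bar> + \<bar>P $ i $ i * x $ i\<bar>"
      by (rule abs_triangle_ineq4)
    then show "\<bar>(P *v x) $ i - P $ i $ i * x $ i\<bar> \<le> \<bar>(B *v b) $ i\<bar> + P $ i $ i"
      using P0[of i] by (simp add: abs_mult abs_hypercube[OF x])
        (simp add: P_def b_def matrix_vector_mul_assoc)
  qed auto
  also have "\<dots> = (\<Sum>i\<in>UNIV. \<bar>(B *v b) $ i\<bar> * \<bar>b $ i\<bar>) + (\<Sum>i\<in>UNIV. P $ i $ i * \<bar>b $ i\<bar>)"
    by (simp add: distrib_right sum.distrib)
  also have "\<dots> \<le> S * norm b * norm b + (\<Sum>i\<in>UNIV. S * (P $ i $ i + (b $ i)\<^sup>2) / 2)"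
    unfolding S_def[symmetric]
    by (intro add_mono sum_mono Pd order_trans[OF sum_abs_mult_le_norm] mult_right_mono)
      (auto simp: S_def norm_matrix_vector_le_spectral)
  also have "(\<Sum>i\<in>UNIV. S * (P $ i $ i + (b $ i)\<^sup>2) / 2) = S * (trace P + (norm b)\<^sup>2) / 2"
    unfolding power2_norm_eq_inner inner_vec_def
    by (simp add: trace_def sum.distrib power2_eq_square
        sum_distrib_left[symmetric] sum_divide_distrib[symmetric])
  finally show ?thesis
    unfolding P_def F_def trace_square_symmetric[OF B]
    by (simp add: b_def P_def field_simps power2_eq_square)
qed

section \<open>The moment generating function over the hypercube\<close>

text \<open>The squared norm is the quadratic form of \<open>B ** B\<close>, whose trace is F^2.
  Integration by parts reproduces the sum \<open>G\<close> on the right with the small factor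
  \<open>3 * u\<close>, so it can be absorbed on the left.\<close>

lemma sum_norm_square_exp_le:
  fixes B :: "real ^ 'n ^ 'n"
  assumes B: "transpose B = B" "\<And>i. B $ i $ i = 0"
    and t: "t \<ge> 0" "4 * t * spectral_norm B < 1"
  shows "(1 - 4 * t * spectral_norm B)
      * (\<Sum>x\<in>hypercube. (norm (B *v x))\<^sup>2 * exp (t * (x \<bullet> (B *v x))))
    \<le> (frobenius_norm B)\<^sup>2 * (\<Sum>x\<in>hypercube. exp (t * (x \<bullet> (B *v x))))"
proof -
  define w where "w x = exp (t * (x \<bullet> (B *v x)))" for x
  define F where "F = frobenius_norm B"
  define u where "u = t * spectral_norm B"
  define G where "G = (\<Sum>x\<in>hypercube. (norm (B *v x))\<^sup>2 * w x)"
  define Z where "Z = (\<Sum>x\<in>hypercube. w x)"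
  have u: "0 \<le> u" "4 * u < 1"
    using t spectral_norm_nonneg[of B] by (auto simp: u_def)
  have "G = (\<Sum>x\<in>hypercube. (x \<bullet> ((B ** B) *v x)) * w x)"
    unfolding G_def power2_norm_eq_inner inner_matrix_vector_symmetric[OF B(1), symmetric]
      matrix_vector_mul_assoc ..
  also have "\<dots> \<le> (\<Sum>x\<in>hypercube. (trace (B ** B)
          + 2 * t * (\<Sum>i\<in>UNIV. \<bar>((B ** B) *v x) $ i - (B ** B) $ i $ i * x $ i\<bar> * \<bar>(B *v x) $ i\<bar>))
        * w x)"
    unfolding w_def by (rule sum_quadratic_form_exp_le[OF B t(1)])
  also have "\<dots> \<le> (\<Sum>x\<in>hypercube. (F\<^sup>2
          + 2 * t * (spectral_norm B * (F\<^sup>2 + 3 * (norm (B *v x))\<^sup>2) / 2)) * w x)"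
    unfolding F_def using t(1)
    by (intro sum_mono mult_right_mono add_mono mult_left_mono off_diagonal_square_le B)
      (auto simp: w_def trace_square_symmetric[OF B(1)])
  also have "\<dots> = (\<Sum>x\<in>hypercube. (1 + u) * F\<^sup>2 * w x + 3 * u * ((norm (B *v x))\<^sup>2 * w x))"
    by (intro sum.cong) (auto simp: u_def algebra_simps)
  also have "\<dots> = (1 + u) * F\<^sup>2 * Z + 3 * u * G"
    by (simp add: sum.distrib sum_distrib_left Z_def G_def)
  finally have "(1 - 3 * u) * G \<le> (1 + u) * (F\<^sup>2 * Z)"
    by (simp add: algebra_simps)
  \<comment> \<open>The factor (1 + u) / (1 - 3u) is at most 1 / (1 - 4u), as (1 - 4u)(1 + u) = 1 -
    3u - 4u^2. Multiplying first and cancelling the positive 1 - 3u avoids fractions.\<close>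
  then have "(1 - 4 * u) * ((1 - 3 * u) * G) \<le> (1 - 4 * u) * ((1 + u) * (F\<^sup>2 * Z))"
    using u by (intro mult_left_mono) auto
  also have "\<dots> = (1 - 3 * u - 4 * u\<^sup>2) * (F\<^sup>2 * Z)"
    by (simp add: algebra_simps power2_eq_square)
  also have "\<dots> \<le> (1 - 3 * u) * (F\<^sup>2 * Z)"
    by (intro mult_right_mono) (auto simp: Z_def w_def sum_nonneg)
  finally have "(1 - 3 * u) * ((1 - 4 * u) * G) \<le> (1 - 3 * u) * (F\<^sup>2 * Z)"
    by (simp add: mult.left_commute)
  then have "(1 - 4 * u) * G \<le> F\<^sup>2 * Z"
    using u by (subst (asm) mult_le_cancel_left_pos) auto
  then show ?thesis
    by (simp add: u_def G_def Z_def F_def w_def mult.assoc)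
qed

text \<open>A Gronwall argument: the derivative of \<open>Z\<close> is at most
  \<open>2 * t * K * Z t\<close>, so multiplying by exp (- K t^2) gives a function that does not
  increase from \<open>Z 0\<close>, the cardinality.\<close>

lemma sum_exp_quadratic_form_le:
  fixes B :: "real ^ 'n ^ 'n"
  assumes B: "transpose B = B" "\<And>i. B $ i $ i = 0"
    and T: "T \<ge> 0" "4 * T * spectral_norm B < 1"
  shows "(\<Sum>x\<in>hypercube. exp (T * (x \<bullet> (B *v x))))
    \<le> card (hypercube :: (real ^ 'n) set)
      * exp (T\<^sup>2 * (frobenius_norm B)\<^sup>2 / (1 - 4 * T * spectral_norm B))"
proof -
  define q where "q x = x \<bullet> (B *v x)" for x
  define S where "S = spectral_norm B"
  define F where "F = frobenius_norm B"
  \<comment> \<open>\<open>K\<close> is frozen at the endpoint \<open>T\<close>, where the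
    denominator is smallest, so one constant serves the whole interval.\<close>
  define K where "K = F\<^sup>2 / (1 - 4 * T * S)"
  define Z where "Z t = (\<Sum>x\<in>hypercube. exp (t * q x))" for t
  have S: "0 \<le> S" unfolding S_def by (rule spectral_norm_nonneg)
  have dZ: "(\<Sum>x\<in>hypercube. q x * exp (t * q x)) \<le> 2 * t * K * Z t" if t: "0 \<le> t" "t \<le> T" for t
  proof -
    have le: "4 * t * S \<le> 4 * T * S"
      using t S by (intro mult_right_mono) auto
    have tS: "4 * t * S < 1"
      using le T(2) unfolding S_def by linarith
    define G where "G = (\<Sum>x\<in>hypercube. (norm (B *v x))\<^sup>2 * exp (t * q x))"
    have G0: "0 \<le> G"
      by (simp add: G_def sum_nonneg)
    have "(1 - 4 * T * S) * G \<le> (1 - 4 * t * S) * G"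
      using le G0 by (intro mult_right_mono) auto
    also have "\<dots> \<le> F\<^sup>2 * Z t"
      unfolding S_def F_def Z_def G_def q_def
      by (rule sum_norm_square_exp_le[OF B t(1)]) (use tS S_def in auto)
    finally have G: "G \<le> K * Z t"
      using T(2) by (simp add: K_def S_def field_simps)
    \<comment> \<open>For \<open>P = B\<close> the diagonal and the trace vanish, so the general
      bound becomes \<open>2 * t * G\<close>.\<close>
    have norm: "(\<Sum>i\<in>UNIV. \<bar>(B *v x) $ i - B $ i $ i * x $ i\<bar> * \<bar>(B *v x) $ i\<bar>)
        = (norm (B *v x))\<^sup>2" for x
      by (simp add: B(2) power2_norm_eq_inner inner_vec_def)
    have tr: "trace B = 0"
      by (simp add: trace_def B(2))
    have "(\<Sum>x\<in>hypercube. q x * exp (t * q x)) \<le> 2 * t * G"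
      using sum_quadratic_form_exp_le[OF B t(1), of B]
      unfolding norm tr G_def q_def by (simp add: sum_distrib_left mult.assoc)
    also have "\<dots> \<le> 2 * t * (K * Z t)"
      using G t by (intro mult_left_mono) auto
    finally show ?thesis by (simp add: mult.assoc)
  qed
  have "Z 0 * exp (- K * 0\<^sup>2) \<ge> Z T * exp (- K * T\<^sup>2)"
  proof (rule DERIV_nonpos_imp_nonincreasing[OF T(1)])
    fix t assume t: "0 \<le> t" "t \<le> T"
    have "((\<lambda>t. Z t * exp (- K * t\<^sup>2)) has_real_derivative
        ((\<Sum>x\<in>hypercube. q x * exp (t * q x)) - 2 * t * K * Z t) * exp (- K * t\<^sup>2)) (at t)"
      unfolding Z_def by (auto intro!: derivative_eq_intros simp: algebra_simps)
    moreover have "((\<Sum>x\<in>hypercube. q x * exp (t * q x)) - 2 * t * K * Z t) * exp (- K * t\<^sup>2) \<le> 0"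
      using dZ[OF t] by (simp add: mult_nonpos_nonneg)
    ultimately show "\<exists>y. ((\<lambda>t. Z t * exp (- K * t\<^sup>2)) has_real_derivative y) (at t) \<and> y \<le> 0"
      by blast
  qed
  then have "Z T \<le> Z 0 * exp (K * T\<^sup>2)"
    by (simp add: exp_minus field_simps)
  then show ?thesis
    by (simp add: Z_def q_def K_def F_def S_def mult.commute)
qed

section \<open>Rademacher vectors and Chernoff bounds\<close>

lemma (in prob_space) AE_rademacher_vector_hypercube:
  fixes X :: "'a \<Rightarrow> real ^ 'n"
  assumes "rademacher_vector X"
  shows "AE \<omega> in M. X \<omega> \<in> hypercube"
proof -
  have "AE \<omega> in M. X \<omega> $ j = 1 \<or> X \<omega> $ j = - 1" for j
  proof -
    have [measurable]: "(\<lambda>\<omega>. X \<omega> $ j) \<in> borel_measurable M"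
      using assms by (auto simp: rademacher_vector_def indep_vars_def)
    have half: "prob {\<omega> \<in> space M. X \<omega> $ j = 1} = 1 / 2"
        "prob {\<omega> \<in> space M. X \<omega> $ j = - 1} = 1 / 2"
      using assms by (auto simp: rademacher_vector_def)
    have "prob {\<omega> \<in> space M. X \<omega> $ j = 1 \<or> X \<omega> $ j = - 1}
        = prob ({\<omega> \<in> space M. X \<omega> $ j = 1} \<union> {\<omega> \<in> space M. X \<omega> $ j = - 1})"
      by (rule arg_cong[where f = prob]) auto
    also have "\<dots> = prob {\<omega> \<in> space M. X \<omega> $ j = 1} + prob {\<omega> \<in> space M. X \<omega> $ j = - 1}"
      by (rule finite_measure_Union) auto
    also have "\<dots> = 1"
      by (simp add: half)
    finally show ?thesis
      by (subst (asm) prob_Collect_eq_1) auto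
  qed
  then show ?thesis
    by (simp add: hypercube_def AE_all_countable)
qed

lemma (in prob_space) prob_rademacher_vector_eq:
  fixes X :: "'a \<Rightarrow> real ^ 'n"
  assumes X: "rademacher_vector X" and x: "x \<in> hypercube"
  shows "prob {\<omega> \<in> space M. X \<omega> = x} = (1 / 2) ^ CARD('n)"
proof -
  have "prob {\<omega> \<in> space M. X \<omega> = x} = prob (\<Inter>j\<in>UNIV. (\<lambda>\<omega>. X \<omega> $ j) -` {x $ j} \<inter> space M)"
    by (rule arg_cong[where f = prob]) (auto simp: vec_eq_iff)
  also have "\<dots> = (\<Prod>j\<in>UNIV. prob ((\<lambda>\<omega>. X \<omega> $ j) -` {x $ j} \<inter> space M))"
    using X by (intro indep_varsD_finite[where M' = "\<lambda>_. borel"]) (auto simp: rademacher_vector_def)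
  also have "\<dots> = (\<Prod>j\<in>(UNIV :: 'n set). 1 / 2)"
  proof (rule prod.cong)
    fix j
    have "(\<lambda>\<omega>. X \<omega> $ j) -` {c} \<inter> space M = {\<omega> \<in> space M. X \<omega> $ j = c}" for c
      by auto
    moreover have "x $ j = 1 \<or> x $ j = - 1"
      using x by (simp add: hypercube_def)
    ultimately show "prob ((\<lambda>\<omega>. X \<omega> $ j) -` {x $ j} \<inter> space M) = 1 / 2"
      using X by (auto simp: rademacher_vector_def)
  qed simp
  finally show ?thesis by simp
qed

text \<open>Almost surely \<open>X\<close> takes one of finitely many values, so
  \<open>f (X \<omega>)\<close> agrees almost everywhere with a finite combination of indicators,
  each of probability 2^-n by independence.\<close>

lemma
  fixes M :: "'a measure" and X :: "'a \<Rightarrow> real ^ 'n" and f :: "real ^ 'n \<Rightarrow> real"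
  assumes "prob_space M" and X: "prob_space.rademacher_vector M X"
    and meas [measurable]: "X \<in> borel_measurable M" "f \<in> borel_measurable borel"
  shows integrable_rademacher_vector: "integrable M (\<lambda>\<omega>. f (X \<omega>))"
    and expectation_rademacher_vector:
      "(\<integral>\<omega>. f (X \<omega>) \<partial>M) = (1 / 2) ^ CARD('n) * (\<Sum>x\<in>hypercube. f x)"
proof -
  interpret prob_space M by fact
  let ?g = "\<lambda>\<omega>. \<Sum>x\<in>hypercube. f x * indicator {\<omega> \<in> space M. X \<omega> = x} \<omega>"
  have eq: "AE \<omega> in M. f (X \<omega>) = ?g \<omega>"
    using AE_rademacher_vector_hypercube[OF X] AE_space
  proof eventually_elim
    case (elim \<omega>)
    have "?g \<omega> = (\<Sum>x\<in>hypercube. if x = X \<omega> then f x else 0)"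
      using elim by (intro sum.cong) (auto simp: indicator_def)
    then show ?case
      using elim by (simp add: finite_hypercube)
  qed
  have int: "integrable M (\<lambda>\<omega>. f x * indicator {\<omega> \<in> space M. X \<omega> = x} \<omega>)" for x
    by (intro integrable_mult_right integrable_real_indicator) (auto simp: emeasure_eq_measure)
  have "integrable M ?g"
    by (intro Bochner_Integration.integrable_sum int)
  then show "integrable M (\<lambda>\<omega>. f (X \<omega>))"
    by (subst integrable_cong_AE[OF _ _ eq]) auto
  have "(\<integral>\<omega>. f (X \<omega>) \<partial>M) = (\<integral>\<omega>. ?g \<omega> \<partial>M)"
    by (rule integral_cong_AE[OF _ _ eq]) auto
  also have "\<dots> = (\<Sum>x\<in>hypercube. \<integral>\<omega>. f x * indicator {\<omega> \<in> space M. X \<omega> = x} \<omega> \<partial>M)"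
    by (intro Bochner_Integration.integral_sum int)
  also have "\<dots> = (\<Sum>x\<in>hypercube. f x * (1 / 2) ^ CARD('n))"
  proof (rule sum.cong)
    fix x :: "real ^ 'n" assume x: "x \<in> hypercube"
    have "{\<omega> \<in> space M. X \<omega> = x} \<in> sets M" by measurable
    then show "(\<integral>\<omega>. f x * indicator {\<omega> \<in> space M. X \<omega> = x} \<omega> \<partial>M) = f x * (1 / 2) ^ CARD('n)"
      using prob_rademacher_vector_eq[OF X x] by simp
  qed simp
  finally show "(\<integral>\<omega>. f (X \<omega>) \<partial>M) = (1 / 2) ^ CARD('n) * (\<Sum>x\<in>hypercube. f x)"
    by (simp add: sum_distrib_right mult.commute)
qed

lemma measurable_exp_quadratic_form [measurable]:
  fixes B :: "real ^ 'n ^ 'n"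
  shows "(\<lambda>x. exp (T * (x \<bullet> (B *v x)))) \<in> borel_measurable borel"
  by (intro borel_measurable_continuous_onI continuous_intros)

lemma expectation_exp_quadratic_form_le:
  fixes M :: "'a measure" and X :: "'a \<Rightarrow> real ^ 'n" and B :: "real ^ 'n ^ 'n"
  assumes M: "prob_space M" and X: "prob_space.rademacher_vector M X" "X \<in> borel_measurable M"
    and B: "transpose B = B" "\<And>i. B $ i $ i = 0"
    and T: "T \<ge> 0" "4 * T * spectral_norm B < 1"
  shows "(\<integral>\<omega>. exp (T * (X \<omega> \<bullet> (B *v X \<omega>))) \<partial>M)
    \<le> exp (T\<^sup>2 * (frobenius_norm B)\<^sup>2 / (1 - 4 * T * spectral_norm B))"
proof -
  interpret prob_space M by fact
  have "(\<integral>\<omega>. exp (T * (X \<omega> \<bullet> (B *v X \<omega>))) \<partial>M)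
      = (1 / 2) ^ CARD('n) * (\<Sum>x\<in>hypercube. exp (T * (x \<bullet> (B *v x))))"
    by (rule expectation_rademacher_vector[OF M X]) measurable
  also have "\<dots> \<le> (1 / 2) ^ CARD('n) * (card (hypercube :: (real ^ 'n) set)
      * exp (T\<^sup>2 * (frobenius_norm B)\<^sup>2 / (1 - 4 * T * spectral_norm B)))"
    by (intro mult_left_mono sum_exp_quadratic_form_le B T) simp
  \<comment> \<open>The expectation formula at the constant 1 shows that the normalising power
    cancels the cardinality, without counting the hypercube.\<close>
  also have "\<dots> = exp (T\<^sup>2 * (frobenius_norm B)\<^sup>2 / (1 - 4 * T * spectral_norm B))"
    using expectation_rademacher_vector[OF M X, of "\<lambda>_. 1"] prob_space by simp
  finally show ?thesis .
qed

section \<open>Chernoff bounds for independent quadratic forms\<close>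

text \<open>Supplies the form of integrability in which \<open>Chernoff_ineq_ge\<close> is
  phrased.\<close>

lemma space_set_integrable: "set_integrable M (space M) f \<longleftrightarrow> integrable M f"
  for f :: "'a \<Rightarrow> real"
  unfolding set_integrable_def by (rule Bochner_Integration.integrable_cong) auto

text \<open>By independence the moment generating function factorises. Bounding every denominator
  through the common \<open>S\<close> lets the exponents add up to a multiple of
  \<open>v\<close>.\<close>

lemma prob_sum_quadratic_forms_ge:
  fixes M :: "'a measure" and X :: "'i \<Rightarrow> 'a \<Rightarrow> real ^ 'n" and B :: "'i \<Rightarrow> real ^ 'n ^ 'n"
  assumes M: "prob_space M" and I: "finite I"
    and X: "\<And>p. p \<in> I \<Longrightarrow> prob_space.rademacher_vector M (X p)"
    and indep: "prob_space.indep_vars M (\<lambda>_. borel) X I"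
    and B: "\<And>p. p \<in> I \<Longrightarrow> transpose (B p) = B p" "\<And>p i. p \<in> I \<Longrightarrow> B p $ i $ i = 0"
    and c: "\<And>p. p \<in> I \<Longrightarrow> 0 \<le> c p"
    and v: "v = (\<Sum>p\<in>I. (c p)\<^sup>2 * (frobenius_norm (B p))\<^sup>2)" "0 < v"
    and S: "\<And>p. p \<in> I \<Longrightarrow> c p * spectral_norm (B p) \<le> S" "0 \<le> S"
    and eps: "0 < \<epsilon>"
  shows "\<P>(\<omega> in M. (\<Sum>p\<in>I. c p * (X p \<omega> \<bullet> (B p *v X p \<omega>))) \<ge> \<epsilon>)
    \<le> exp ((- \<epsilon>\<^sup>2 / 8) / (v + \<epsilon> * S))"
proof -
  interpret prob_space M by fact
  \<comment> \<open>This choice gives T (v + \<epsilon> S) = \<epsilon>/4 and T^2 v / (1 - 4 T S) =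
    T \<epsilon>/4, hence the total exponent -3/4 T \<epsilon>.\<close>
  define T where "T = \<epsilon> / (4 * (v + \<epsilon> * S))"
  have den: "0 < v + \<epsilon> * S"
    using v(2) S(2) eps by (simp add: add_pos_nonneg)
  have T: "0 < T"
    using den eps by (simp add: T_def)
  have TS: "1 - 4 * T * S = v / (v + \<epsilon> * S)"
    using den by (simp add: T_def field_simps)
  then have TS0: "0 < 1 - 4 * T * S"
    using den v by simp
  have meas: "X p \<in> borel_measurable M" if "p \<in> I" for p
    using indep that by (auto simp: indep_vars_def)
  define Y where "Y p \<omega> = exp ((T * c p) * (X p \<omega> \<bullet> (B p *v X p \<omega>)))" for p \<omega>
  have Y: "indep_vars (\<lambda>_. borel) Y I"
    unfolding Y_def by (rule indep_vars_compose2[OF indep]) measurable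
  have int: "integrable M (Y p)" if "p \<in> I" for p
    unfolding Y_def
    by (rule integrable_rademacher_vector[OF M X[OF that] meas[OF that]]) measurable
  have prod: "exp (T * (\<Sum>p\<in>I. c p * (X p \<omega> \<bullet> (B p *v X p \<omega>)))) = (\<Prod>p\<in>I. Y p \<omega>)" for \<omega>
    by (simp add: Y_def exp_sum[OF I] sum_distrib_left mult.assoc)
  have EY: "expectation (Y p) \<le> exp (T\<^sup>2 * ((c p)\<^sup>2 * (frobenius_norm (B p))\<^sup>2) / (1 - 4 * T * S))"
    if p: "p \<in> I" for p
  proof -
    have TcS: "4 * (T * c p) * spectral_norm (B p) \<le> 4 * T * S"
      using S(1)[OF p] T by simp
    then have "4 * (T * c p) * spectral_norm (B p) < 1"
      using TS0 by linarith
    then have "expectation (Y p)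
        \<le> exp ((T * c p)\<^sup>2 * (frobenius_norm (B p))\<^sup>2 / (1 - 4 * (T * c p) * spectral_norm (B p)))"
      unfolding Y_def using T c[OF p]
      by (intro expectation_exp_quadratic_form_le M X meas B p) auto
    also have "\<dots> \<le> exp ((T * c p)\<^sup>2 * (frobenius_norm (B p))\<^sup>2 / (1 - 4 * T * S))"
      using TcS TS0 by (simp add: frac_le)
    finally show ?thesis
      by (simp add: power_mult_distrib mult.assoc)
  qed
  have "\<P>(\<omega> in M. (\<Sum>p\<in>I. c p * (X p \<omega> \<bullet> (B p *v X p \<omega>))) \<ge> \<epsilon>)
      \<le> exp (- T * \<epsilon>) * (\<integral>\<omega>\<in>space M. exp (T * (\<Sum>p\<in>I. c p * (X p \<omega> \<bullet> (B p *v X p \<omega>)))) \<partial>M)"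
    unfolding prod[symmetric]
    by (rule Chernoff_ineq_ge[OF T])
      (simp_all add: prod space_set_integrable indep_vars_integrable[OF I Y int])
  also have "(\<integral>\<omega>\<in>space M. exp (T * (\<Sum>p\<in>I. c p * (X p \<omega> \<bullet> (B p *v X p \<omega>)))) \<partial>M)
      = (\<Prod>p\<in>I. expectation (Y p))"
    unfolding prod
    by (simp add: set_integral_space indep_vars_integrable[OF I Y int]
        indep_vars_lebesgue_integral[OF I Y int])
  also have "\<dots> \<le> (\<Prod>p\<in>I. exp (T\<^sup>2 * ((c p)\<^sup>2 * (frobenius_norm (B p))\<^sup>2) / (1 - 4 * T * S)))"
    by (intro prod_mono conjI EY) (auto simp: Y_def)
  also have "\<dots> = exp (T\<^sup>2 * v / (1 - 4 * T * S))"
    by (simp add: v(1) exp_sum[OF I] sum_distrib_left sum_divide_distrib)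
  also have "exp (- T * \<epsilon>) * exp (T\<^sup>2 * v / (1 - 4 * T * S)) = exp (- (3 / 4 * (T * \<epsilon>)))"
  proof -
    have scale: "\<epsilon> / (4 * D) * D = \<epsilon> / 4" if "0 < D" for D
      using that by simp
    have "T\<^sup>2 * v / (1 - 4 * T * S) = T * (T * (v + \<epsilon> * S))"
      using v(2) den by (simp add: TS power2_eq_square)
    also have "T * (v + \<epsilon> * S) = \<epsilon> / 4"
      unfolding T_def by (rule scale[OF den])
    finally have e: "T\<^sup>2 * v / (1 - 4 * T * S) = T * (\<epsilon> / 4)" .
    have "- T * \<epsilon> + T\<^sup>2 * v / (1 - 4 * T * S) = - (3 / 4 * (T * \<epsilon>))"
      unfolding e by (simp add: field_simps)
    then show ?thesis
      by (simp only: exp_add[symmetric])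
  qed
  \<comment> \<open>T \<epsilon>/2 is exactly \<epsilon>^2/8 divided by v + \<epsilon> S, so 3/4 is
    weakened to 1/2.\<close>
  also have "\<dots> \<le> exp (- (T * \<epsilon> / 2))"
    using T eps by simp
  also have "- (T * \<epsilon> / 2) = (- \<epsilon>\<^sup>2 / 8) / (v + \<epsilon> * S)"
    using den by (simp add: T_def power2_eq_square)
  finally show ?thesis by simp
qed

lemma minus_matrix_vector_mult: "(- B) *v x = - (B *v x)" for B :: "real ^ 'n ^ 'm"
  by (simp add: vec_eq_iff matrix_vector_mult_def sum_negf)

lemma spectral_norm_minus: "spectral_norm (- B) = spectral_norm B" for B :: "real ^ 'n ^ 'm"
  by (simp add: spectral_norm_def minus_matrix_vector_mult onorm_neg)

lemma frobenius_norm_minus: "frobenius_norm (- B) = frobenius_norm B" for B :: "real ^ 'n ^ 'm"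
  by (simp add: frobenius_norm_def)

lemma frobenius_norm_pos_iff: "0 < frobenius_norm B \<longleftrightarrow> B \<noteq> 0" for B :: "real ^ 'n ^ 'm"
proof -
  have "frobenius_norm B = 0 \<longleftrightarrow> B = 0"
    by (simp add: frobenius_norm_def sum_nonneg_eq_0_iff sum_nonneg vec_eq_iff)
  moreover have "0 \<le> frobenius_norm B"
    by (simp add: frobenius_norm_def sum_nonneg)
  ultimately show ?thesis by auto
qed

text \<open>The lower tail is the upper tail for the matrices \<open>- B p\<close>, which keep
  symmetry, zero diagonal and both norms; the union bound gives the factor 2.\<close>

lemma prob_abs_sum_quadratic_forms_ge:
  fixes M :: "'a measure" and X :: "'i \<Rightarrow> 'a \<Rightarrow> real ^ 'n" and B :: "'i \<Rightarrow> real ^ 'n ^ 'n"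
  assumes M: "prob_space M" and I: "finite I"
    and X: "\<And>p. p \<in> I \<Longrightarrow> prob_space.rademacher_vector M (X p)"
    and indep: "prob_space.indep_vars M (\<lambda>_. borel) X I"
    and B: "\<And>p. p \<in> I \<Longrightarrow> transpose (B p) = B p" "\<And>p i. p \<in> I \<Longrightarrow> B p $ i $ i = 0"
    and c: "\<And>p. p \<in> I \<Longrightarrow> 0 \<le> c p"
    and v: "v = (\<Sum>p\<in>I. (c p)\<^sup>2 * (frobenius_norm (B p))\<^sup>2)" "0 < v"
    and S: "\<And>p. p \<in> I \<Longrightarrow> c p * spectral_norm (B p) \<le> S" "0 \<le> S"
    and eps: "0 < \<epsilon>"
  shows "\<P>(\<omega> in M. \<bar>\<Sum>p\<in>I. c p * (X p \<omega> \<bullet> (B p *v X p \<omega>))\<bar> \<ge> \<epsilon>)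
    \<le> 2 * exp ((- \<epsilon>\<^sup>2 / 8) / (v + \<epsilon> * S))"
proof -
  interpret prob_space M by fact
  define Q where "Q \<omega> = (\<Sum>p\<in>I. c p * (X p \<omega> \<bullet> (B p *v X p \<omega>)))" for \<omega>
  have "(\<lambda>\<omega>. c p * (X p \<omega> \<bullet> (B p *v X p \<omega>))) \<in> borel_measurable M" if "p \<in> I" for p
  proof (rule measurable_compose[where g = "\<lambda>x. c p * (x \<bullet> (B p *v x))"])
    show "X p \<in> borel_measurable M"
      using indep that by (auto simp: indep_vars_def)
    show "(\<lambda>x. c p * (x \<bullet> (B p *v x))) \<in> borel_measurable borel"
      by (intro borel_measurable_continuous_onI continuous_intros)
  qed
  then have [measurable]: "Q \<in> borel_measurable M"
    unfolding Q_def by (intro borel_measurable_sum)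
  have neg: "(\<Sum>p\<in>I. c p * (X p \<omega> \<bullet> ((- B p) *v X p \<omega>))) = - Q \<omega>" for \<omega>
    by (simp add: Q_def sum_negf minus_matrix_vector_mult)
  have "prob {\<omega> \<in> space M. Q \<omega> \<ge> \<epsilon>} \<le> exp ((- \<epsilon>\<^sup>2 / 8) / (v + \<epsilon> * S))"
    unfolding Q_def by (rule prob_sum_quadratic_forms_ge[OF M I X indep B c v S eps])
  moreover have "prob {\<omega> \<in> space M. - Q \<omega> \<ge> \<epsilon>} \<le> exp ((- \<epsilon>\<^sup>2 / 8) / (v + \<epsilon> * S))"
    unfolding neg[symmetric]
    by (rule prob_sum_quadratic_forms_ge[OF M I X indep _ _ c _ v(2) _ S(2) eps])
      (use B S(1) in \<open>auto simp: spectral_norm_minus frobenius_norm_minus v(1) transpose_def vec_eq_iff\<close>)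
  moreover have "prob {\<omega> \<in> space M. \<bar>Q \<omega>\<bar> \<ge> \<epsilon>}
      \<le> prob {\<omega> \<in> space M. Q \<omega> \<ge> \<epsilon>} + prob {\<omega> \<in> space M. - Q \<omega> \<ge> \<epsilon>}"
  proof -
    have "{\<omega> \<in> space M. \<bar>Q \<omega>\<bar> \<ge> \<epsilon>}
        = {\<omega> \<in> space M. Q \<omega> \<ge> \<epsilon>} \<union> {\<omega> \<in> space M. - Q \<omega> \<ge> \<epsilon>}"
      by auto
    then show ?thesis
      by (simp add: measure_Un_le)
  qed
  ultimately show ?thesis
    by (simp add: Q_def)
qed

section \<open>Diagonal parts and traces\<close>

text \<open>Entries of absolute value 1 turn the diagonal part into a constant, so deviations from
  the trace involve only \<open>zero_diagonal A\<close>.\<close>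

lemma quadratic_form_zero_diagonal:
  fixes A :: "real ^ 'n ^ 'n"
  assumes "x \<in> hypercube"
  shows "x \<bullet> (A *v x) = trace A + x \<bullet> (zero_diagonal A *v x)"
proof -
  have "(A *v x) $ i = A $ i $ i * x $ i + (zero_diagonal A *v x) $ i" for i
  proof -
    have "(A *v x) $ i = (\<Sum>j\<in>UNIV. (if j = i then A $ i $ j * x $ j else 0)
        + zero_diagonal A $ i $ j * x $ j)"
      unfolding matrix_vector_mult_def by (auto intro!: sum.cong simp: zero_diagonal_def)
    then show ?thesis
      by (simp add: sum.distrib matrix_vector_mult_def)
  qed
  then have "x \<bullet> (A *v x) = (\<Sum>i\<in>UNIV. A $ i $ i * (x $ i * x $ i)) + x \<bullet> (zero_diagonal A *v x)"
    by (simp add: inner_vec_def distrib_left sum.distrib mult.left_commute)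
  then show ?thesis
    by (simp add: trace_def square_hypercube[OF assms])
qed

lemma trace_sum: "trace (\<Sum>k\<in>I. A k) = (\<Sum>k\<in>I. trace (A k))" for A :: "'i \<Rightarrow> real ^ 'n ^ 'n"
  unfolding trace_def by (simp add: sum_component) (rule sum.swap)

section \<open>Sample sizes for a prescribed failure probability\<close>

text \<open>Bounding the maximum by the sum merges the two terms of the denominator into the sum of
  V_k / m_k. The sample sizes make this at most \<epsilon>^2 / (8 ln (2/\<delta>)), and then the
  exponential is at most \<delta>/2.\<close>

lemma tail_bound_le_delta:
  fixes B :: "nat \<Rightarrow> real ^ 'n ^ 'n" and C :: "nat \<Rightarrow> real"
  assumes eps: "0 < \<epsilon>" and \<delta>: "0 < \<delta>" "\<delta> < 1" and C: "\<And>k. k \<in> {1..L} \<Longrightarrow> 0 < C k"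
    and m: "\<And>k. k \<in> {1..L} \<Longrightarrow> 0 < m k"
    and V: "V = (\<lambda>k. (frobenius_norm (B k))\<^sup>2 + \<epsilon> * spectral_norm (B k))"
    and mu: "\<mu> = 8 / \<epsilon>\<^sup>2 * ln (2 / \<delta>) * (\<Sum>k=1..L. sqrt (V k * C k))"
    and mk: "\<And>k. k \<in> {1..L} \<Longrightarrow> \<mu> * sqrt (V k / C k) \<le> real (m k)"
  shows "tail_bound L m B \<epsilon> \<le> \<delta>"
proof (cases "\<forall>k\<in>{1..L}. B k = 0")
  case True
  then show ?thesis using \<delta> by (simp add: tail_bound_def)
next
  case False
  then obtain k0 where k0: "k0 \<in> {1..L}" "B k0 \<noteq> 0" by blast
  define s where "s = (\<Sum>k=1..L. sqrt (V k * C k))"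
  define D where "D = (\<Sum>k=1..L. (frobenius_norm (B k))\<^sup>2 / real (m k))
      + \<epsilon> * (MAX k\<in>{1..L}. spectral_norm (B k) / real (m k))"
  have V0: "0 \<le> V k" for k
    using eps spectral_norm_nonneg[of "B k"] by (simp add: V)
  have Vk0: "0 < V k0"
    using k0(2) eps spectral_norm_nonneg[of "B k0"] frobenius_norm_pos_iff[of "B k0"]
    by (simp add: V add_pos_nonneg)
  \<comment> \<open>A nonzero \<open>B k0\<close> makes \<open>s\<close> positive; with \<delta> < 1
    also \<mu> is positive and may be divided by.\<close>
  have s: "0 < s"
    unfolding s_def
    by (rule sum_pos2[of _ k0]) (use k0 Vk0 V0 C less_imp_le[OF C] in auto)
  have l: "0 < ln (2 / \<delta>)"
    using \<delta> by simp
  have mu_s: "\<mu> = 8 / \<epsilon>\<^sup>2 * ln (2 / \<delta>) * s"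
    unfolding mu s_def ..
  have mu0: "0 < \<mu>"
    using l s eps by (simp add: mu_s)
  have Vm: "V k / real (m k) \<le> sqrt (V k * C k) / \<mu>" if k: "k \<in> {1..L}" for k
  proof -
    \<comment> \<open>The roots of V_k C_k and V_k / C_k multiply to V_k.\<close>
    have "V k * \<mu> = sqrt (V k * C k) * (\<mu> * sqrt (V k / C k))"
      using C[OF k] V0[of k] by (simp add: real_sqrt_mult real_sqrt_divide)
    also have "\<dots> \<le> sqrt (V k * C k) * real (m k)"
      using C[OF k] V0[of k] by (intro mult_left_mono mk k) simp
    finally show ?thesis
      using m[OF k] mu0 by (simp add: field_simps)
  qed
  have "(MAX k\<in>{1..L}. spectral_norm (B k) / real (m k))
      \<le> (\<Sum>k=1..L. spectral_norm (B k) / real (m k))"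
    using k0(1) by (intro Max.boundedI) (auto intro!: member_le_sum simp: spectral_norm_nonneg)
  then have "D \<le> (\<Sum>k=1..L. (frobenius_norm (B k))\<^sup>2 / real (m k))
      + \<epsilon> * (\<Sum>k=1..L. spectral_norm (B k) / real (m k))"
    unfolding D_def using eps by simp
  also have "\<dots> = (\<Sum>k=1..L. V k / real (m k))"
    by (simp add: V sum_distrib_left sum.distrib add_divide_distrib)
  also have "\<dots> \<le> (\<Sum>k=1..L. sqrt (V k * C k) / \<mu>)"
    by (intro sum_mono Vm)
  also have "\<dots> = s / \<mu>"
    by (simp add: s_def sum_divide_distrib)
  also have "\<dots> = \<epsilon>\<^sup>2 / (8 * ln (2 / \<delta>))"
    using s l eps by (simp add: mu_s field_simps)
  finally have D: "D \<le> \<epsilon>\<^sup>2 / (8 * ln (2 / \<delta>))" .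
  have "0 < (\<Sum>k=1..L. (frobenius_norm (B k))\<^sup>2 / real (m k))"
    by (rule sum_pos2[of _ k0]) (use k0 m frobenius_norm_pos_iff[of "B k0"] in auto)
  moreover have "0 \<le> spectral_norm (B k0) / real (m k0)"
    by (simp add: spectral_norm_nonneg)
  then have "0 \<le> (MAX k\<in>{1..L}. spectral_norm (B k) / real (m k))"
    using k0(1) by (subst Max_ge_iff) auto
  ultimately have D0: "0 < D"
    unfolding D_def using eps by (simp add: add_pos_nonneg)
  have "ln (2 / \<delta>) \<le> \<epsilon>\<^sup>2 / 8 / D"
    using D D0 l by (simp add: field_simps)
  then have "(- \<epsilon>\<^sup>2 / 8) / D \<le> - ln (2 / \<delta>)"
    by simp
  then have "2 * exp ((- \<epsilon>\<^sup>2 / 8) / D) \<le> 2 * exp (- ln (2 / \<delta>))"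
    by simp
  also have "\<dots> = \<delta>"
    using \<delta> by (simp add: exp_minus)
  finally show ?thesis
    unfolding tail_bound_def D_def[symmetric] by (simp only: False if_False)
qed

section \<open>Deviation of the multilevel estimator\<close>

theorem theorem4p2:
  fixes M :: "'a measure"
    and Ahat :: "real ^ 'n ^ 'n"
    and A B :: "nat \<Rightarrow> real ^ 'n ^ 'n"
    and L :: nat
    and m :: "nat \<Rightarrow> nat"
    and z :: "nat \<Rightarrow> nat \<Rightarrow> 'a \<Rightarrow> real ^ 'n"
  assumes "prob_space M"
    and "Ahat \<noteq> 0" and "transpose Ahat = Ahat"
    and "\<And>k. k \<in> {1..L} \<Longrightarrow> transpose (A k) = A k"
    and "Ahat = (\<Sum>k=1..L. A k)"
    and "\<And>k. k \<in> {1..L} \<Longrightarrow> B k = zero_diagonal (A k)"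
    and "\<And>k. k \<in> {1..L} \<Longrightarrow> m k > 0"
    and "\<And>k i. k \<in> {1..L} \<Longrightarrow> i \<in> {1..m k} \<Longrightarrow> prob_space.rademacher_vector M (z k i)"
    and "prob_space.indep_vars M (\<lambda>_. borel) (\<lambda>(k, i). z k i) (SIGMA k:{1..L}. {1..m k})"
  shows
    "(\<forall>\<epsilon>>0. \<P>(\<omega> in M. \<bar>multilevel_estimator L m A z \<omega> - trace Ahat\<bar> \<ge> \<epsilon>)
              \<le> tail_bound L m B \<epsilon>) \<and>
     (\<forall>(\<epsilon>::real) (\<delta>::real) (C :: nat \<Rightarrow> real).
        \<epsilon> > 0 \<longrightarrow> \<delta> > 0 \<longrightarrow> (\<forall>k\<in>{1..L}. C k > 0) \<longrightarrow>
        (let V = (\<lambda>k. (frobenius_norm (B k))\<^sup>2 + \<epsilon> * spectral_norm (B k));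
             \<mu> = 8 / \<epsilon>\<^sup>2 * ln (2 / \<delta>) * (\<Sum>k=1..L. sqrt (V k * C k))
         in (\<forall>k\<in>{1..L}. real (m k) \<ge> \<mu> * sqrt (V k / C k)) \<longrightarrow>
            \<P>(\<omega> in M. \<bar>multilevel_estimator L m A z \<omega> - trace Ahat\<bar> \<ge> \<epsilon>) \<le> \<delta>))"
proof -
  interpret prob_space M by fact
  \<comment> \<open>Pairs of level and sample number turn the double sum into one independent family
    with weights 1/m_k.\<close>
  define I where "I = (SIGMA k:{1..L}. {1..m k})"
  define X where "X = (\<lambda>p. z (fst p) (snd p))"
  define c where "c p = 1 / real (m (fst p))" for p :: "nat \<times> nat"
  define Q where "Q \<omega> = (\<Sum>p\<in>I. c p * (X p \<omega> \<bullet> (B (fst p) *v X p \<omega>)))" for \<omega>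
  have I: "finite I" by (simp add: I_def)
  have X: "rademacher_vector (X p)" if "p \<in> I" for p
    using that assms(8) by (auto simp: I_def X_def)
  have indep: "indep_vars (\<lambda>_. borel) X I"
    using assms(9) by (simp add: I_def X_def case_prod_unfold)
  have quad [measurable]: "(\<lambda>x. x \<bullet> (P *v x)) \<in> borel_measurable borel" for P :: "real ^ 'n ^ 'n"
    by (intro borel_measurable_continuous_onI continuous_intros)
  have z: "z k i \<in> borel_measurable M" if "k \<in> {1..L}" "i \<in> {1..m k}" for k i
  proof -
    have "X p \<in> borel_measurable M" if "p \<in> I" for p
      using indep that by (auto simp: indep_vars_def)
    from this[of "(k, i)"] show ?thesis
      using that by (simp add: X_def I_def)
  qed
  have zq [measurable]: "(\<lambda>\<omega>. z k i \<omega> \<bullet> (P *v z k i \<omega>)) \<in> borel_measurable M"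
    if "k \<in> {1..L}" "i \<in> {1..m k}" for k i P
    using measurable_compose[OF z[OF that] quad] .
  \<comment> \<open>The centred estimator and \<open>Q\<close> will agree only almost surely;
    measurability allows their events to be compared by \<open>prob_eq_AE\<close>.\<close>
  have estimator [measurable]: "multilevel_estimator L m A z \<in> borel_measurable M"
    unfolding multilevel_estimator_def[abs_def]
    by (intro borel_measurable_sum borel_measurable_times borel_measurable_const zq)
  have Q_sum: "Q \<omega> = (\<Sum>k=1..L. \<Sum>i=1..m k. 1 / real (m k) * (z k i \<omega> \<bullet> (B k *v z k i \<omega>)))" for \<omega>
    unfolding Q_def I_def c_def X_def by (subst sum.Sigma) (auto simp: case_prod_unfold)
  have [measurable]: "Q \<in> borel_measurable M"
    unfolding Q_sum[abs_def]
    by (intro borel_measurable_sum borel_measurable_times borel_measurable_const zq)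
  have "AE \<omega> in M. \<forall>p\<in>I. X p \<omega> \<in> hypercube"
    using I X by (intro AE_finite_allI AE_rademacher_vector_hypercube)
  then have eq: "AE \<omega> in M. multilevel_estimator L m A z \<omega> - trace Ahat = Q \<omega>"
  proof eventually_elim
    case (elim \<omega>)
    have z: "z k i \<omega> \<in> hypercube" if "k \<in> {1..L}" "i \<in> {1..m k}" for k i
      using bspec[OF elim, of "(k, i)"] that by (simp add: I_def X_def)
    have "multilevel_estimator L m A z \<omega>
        = (\<Sum>k=1..L. \<Sum>i=1..m k. 1 / real (m k) * trace (A k)
            + 1 / real (m k) * (z k i \<omega> \<bullet> (B k *v z k i \<omega>)))"
      unfolding multilevel_estimator_def
    proof (intro sum.cong refl)
      fix k i assume k: "k \<in> {1..L}" and i: "i \<in> {1..m k}"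
      show "1 / real (m k) * (z k i \<omega> \<bullet> (A k *v z k i \<omega>))
          = 1 / real (m k) * trace (A k) + 1 / real (m k) * (z k i \<omega> \<bullet> (B k *v z k i \<omega>))"
        unfolding assms(6)[OF k] distrib_left[symmetric]
          quadratic_form_zero_diagonal[OF z[OF k i], symmetric] ..
    qed
    also have "\<dots> = (\<Sum>k=1..L. \<Sum>i=1..m k. 1 / real (m k) * trace (A k)) + Q \<omega>"
      by (simp add: Q_sum sum.distrib)
    \<comment> \<open>On each level, m_k > 0 equal summands of weight 1/m_k add up to the trace of
      \<open>A k\<close>.\<close>
    also have "(\<Sum>k=1..L. \<Sum>i=1..m k. 1 / real (m k) * trace (A k)) = trace Ahat"
      unfolding assms(5) trace_sum using assms(7) by (intro sum.cong) auto
    finally show ?case by simp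
  qed
  have prob_eq: "\<P>(\<omega> in M. \<bar>multilevel_estimator L m A z \<omega> - trace Ahat\<bar> \<ge> \<epsilon>)
      = \<P>(\<omega> in M. \<bar>Q \<omega>\<bar> \<ge> \<epsilon>)" for \<epsilon>
    using eq by (intro prob_eq_AE) auto
  have B: "transpose (B k) = B k" "B k $ i $ i = 0" if "k \<in> {1..L}" for k i
    using assms(4)[OF that] assms(6)[OF that]
    by (auto simp: zero_diagonal_def transpose_def vec_eq_iff)
  have bound: "\<P>(\<omega> in M. \<bar>multilevel_estimator L m A z \<omega> - trace Ahat\<bar> \<ge> \<epsilon>) \<le> tail_bound L m B \<epsilon>"
    if eps: "0 < \<epsilon>" for \<epsilon>
  proof (cases "\<forall>k\<in>{1..L}. B k = 0")
    case True
    \<comment> \<open>The event for \<open>Q\<close> is then empty because \<epsilon> > 0, which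
      matches the zero branch of \<open>tail_bound\<close>.\<close>
    have "Q \<omega> = 0" for \<omega>
      unfolding Q_sum by (intro sum.neutral ballI) (simp add: True)
    then show ?thesis
      using True eps by (simp add: prob_eq tail_bound_def)
  next
    case False
    then obtain k0 where k0: "k0 \<in> {1..L}" "B k0 \<noteq> 0" by blast
    define v where "v = (\<Sum>k=1..L. (frobenius_norm (B k))\<^sup>2 / real (m k))"
    define S where "S = (MAX k\<in>{1..L}. spectral_norm (B k) / real (m k))"
    \<comment> \<open>Each level has m_k squared weights 1/m_k^2, which sum to 1/m_k.\<close>
    have v: "v = (\<Sum>p\<in>I. (c p)\<^sup>2 * (frobenius_norm (B (fst p)))\<^sup>2)"
    proof -
      have "(\<Sum>p\<in>I. (c p)\<^sup>2 * (frobenius_norm (B (fst p)))\<^sup>2)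
          = (\<Sum>k=1..L. \<Sum>i=1..m k. (1 / real (m k))\<^sup>2 * (frobenius_norm (B k))\<^sup>2)"
        unfolding I_def c_def by (subst sum.Sigma) (auto simp: case_prod_unfold)
      also have "\<dots> = v"
        unfolding v_def using assms(7) by (intro sum.cong) (auto simp: power2_eq_square)
      finally show ?thesis by simp
    qed
    have v0: "0 < v"
      unfolding v_def
      by (rule sum_pos2[of _ k0]) (use k0 assms(7) frobenius_norm_pos_iff[of "B k0"] in auto)
    have S: "spectral_norm (B k) / real (m k) \<le> S" if "k \<in> {1..L}" for k
      unfolding S_def using that by (intro Max_ge) auto
    have "0 \<le> spectral_norm (B k0) / real (m k0)"
      by (simp add: spectral_norm_nonneg)
    then have S0: "0 \<le> S"
      using S[OF k0(1)] by linarith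
    have "\<P>(\<omega> in M. \<bar>Q \<omega>\<bar> \<ge> \<epsilon>) \<le> 2 * exp ((- \<epsilon>\<^sup>2 / 8) / (v + \<epsilon> * S))"
      unfolding Q_def
      by (rule prob_abs_sum_quadratic_forms_ge[OF assms(1) I X indep _ _ _ v v0 _ S0 eps])
        (use B S in \<open>auto simp: I_def c_def\<close>)
    then show ?thesis
      unfolding prob_eq tail_bound_def v_def S_def by (simp only: False if_False)
  qed
  show ?thesis
  proof (intro conjI allI impI)
    fix \<epsilon> :: real assume "0 < \<epsilon>"
    then show "\<P>(\<omega> in M. \<bar>multilevel_estimator L m A z \<omega> - trace Ahat\<bar> \<ge> \<epsilon>) \<le> tail_bound L m B \<epsilon>"
      by (rule bound)
  next
    fix \<epsilon> \<delta> :: real and C :: "nat \<Rightarrow> real"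
    assume *: "0 < \<epsilon>" "0 < \<delta>" "\<forall>k\<in>{1..L}. 0 < C k"
    have "\<P>(\<omega> in M. \<bar>multilevel_estimator L m A z \<omega> - trace Ahat\<bar> \<ge> \<epsilon>) \<le> \<delta>"
      if V: "V = (\<lambda>k. (frobenius_norm (B k))\<^sup>2 + \<epsilon> * spectral_norm (B k))"
        and mu: "\<mu> = 8 / \<epsilon>\<^sup>2 * ln (2 / \<delta>) * (\<Sum>k=1..L. sqrt (V k * C k))"
        and mk: "\<forall>k\<in>{1..L}. real (m k) \<ge> \<mu> * sqrt (V k / C k)" for V \<mu>
    proof (cases "\<delta> < 1")
      case True
      have "tail_bound L m B \<epsilon> \<le> \<delta>"
        by (rule tail_bound_le_delta[OF *(1,2) True _ _ V mu]) (use * assms(7) mk in auto)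
      then show ?thesis
        using bound[OF *(1)] by linarith
    next
      \<comment> \<open>For \<delta> \<ge> 1 the claim is the trivial bound on a
        probability.\<close>
      case False
      then show ?thesis
        using prob_le_1 by (meson linorder_not_less order_trans)
    qed
    then show "let V = (\<lambda>k. (frobenius_norm (B k))\<^sup>2 + \<epsilon> * spectral_norm (B k));
             \<mu> = 8 / \<epsilon>\<^sup>2 * ln (2 / \<delta>) * (\<Sum>k=1..L. sqrt (V k * C k))
         in (\<forall>k\<in>{1..L}. real (m k) \<ge> \<mu> * sqrt (V k / C k)) \<longrightarrow>
            \<P>(\<omega> in M. \<bar>multilevel_estimator L m A z \<omega> - trace Ahat\<bar> \<ge> \<epsilon>) \<le> \<delta>"
      unfolding Let_def by blast
  qed
qed

end
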